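(* Suppose that $\{\tau_{in}\mid n=1,2,\ldots\}$, $i=0,1,2$, are mutually independent sequences, each consisting of independent and identically distributed nonnegative random variables with $0\le\mathbb{E}[\tau_{i1}]<\infty$ and $\mathbb{D}[\tau_{i1}]<\infty$ for $i=0,1,2$. Let $D_0(0)=D_1(0)=D_2(0)=0$ and, for $n=1,2,\ldots$, $$D_0(n)=D_0(n-1)+\tau_{0n},$$ $$D_1(n)=\max\bigl(D_0(n),D_1(n-1),D_2(n-1)\bigr)+\tau_{1n},$$ $$D_2(n)=\max\bigl(D_1(n),D_2(n-1)\bigr)+\tau_{2n}.$$ Then the limit $\gamma=\lim_{n\to\infty}\frac1n D_2(n)$ exists with probability one and $$\gamma=\max\bigl(\mathbb{E}[\tau_{01}],\,\mathbb{E}[\tau_{11}]+\mathbb{E}[\tau_{21}]\bigr).$$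
   Context: $\mathbb{E}$ denotes expectation and $\mathbb{D}$ denotes variance. The recursions model two single-server queues in tandem, initially empty, with an infinite buffer at the first server and a buffer of capacity $0$ at the second, operating under the communication blocking rule (the first server does not initiate a service while the second server's buffer is full). Here $\tau_{0n}$ are interarrival times, $\tau_{in}$ ($i=1,2$) are the service times at server $i$, $D_0(n)$ is the $n$th arrival epoch, and $D_i(n)$ is the $n$th departure epoch from server $i$. The limit $\gamma$ is the mean cycle time of the system. *)

theory Defs
  imports "HOL-Probability.Probability"
begin

end

(* Eliminating the first queue from the recursions, which is possible because service times are
   nonnegative, leaves a Lindley recursion D_2(n) = max (D_0(n)) (D_2(n-1)) + s_n with
   s_n = tau_1n + tau_2n. Subtracting the partial sums of s turns D_2 into the running maximum of
   D_0(k) - (s_1 + ... + s_{k-1}), which grows at rate max(0, E tau_0 - E s). The strong law for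
   nonnegative summands with bounded variance follows from convergence of averages along the squares,
   where the variances of the averages are summable, and from monotonicity of the partial sums. *)
theory Submission
  imports Defs "HOL-Real_Asymp.Real_Asymp"
begin

section \<open>Strong law of large numbers\<close>

text \<open>Every \<open>n\<close> lies between consecutive squares whose ratio to \<open>n\<close>
  tends to 1. Monotonicity thus sandwiches the average at \<open>n\<close> between averages along
  squares, rescaled by factors tending to 1.\<close>

lemma average_tendsto_from_squares:
  fixes S :: "nat \<Rightarrow> real"
  assumes mono: "mono S" and nonneg: "\<And>n. 0 \<le> S n"
    and lim: "(\<lambda>k. S (k\<^sup>2) / real (k\<^sup>2)) \<longlonglongrightarrow> \<mu>"
  shows "(\<lambda>n. S n / real n) \<longlonglongrightarrow> \<mu>"
proof -
  define r where "r n = nat \<lfloor>sqrt (real n)\<rfloor>" for n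
  have r_lim: "filterlim r sequentially sequentially"
    unfolding r_def by real_asymp
  have r_le: "(r n)\<^sup>2 \<le> n" and le_r: "n \<le> (Suc (r n))\<^sup>2" for n
  proof -
    have "real (r n) \<le> sqrt (real n)" by (simp add: r_def)
    then have "(real (r n))\<^sup>2 \<le> (sqrt (real n))\<^sup>2" by (intro power_mono) auto
    then have "real ((r n)\<^sup>2) \<le> real n" by simp
    then show "(r n)\<^sup>2 \<le> n" by (simp only: of_nat_le_iff)
    have "sqrt (real n) \<le> real (Suc (r n))" unfolding r_def by linarith
    then have "(sqrt (real n))\<^sup>2 \<le> (real (Suc (r n)))\<^sup>2" by (intro power_mono) auto
    then have "real n \<le> real ((Suc (r n))\<^sup>2)" by simp
    then show "n \<le> (Suc (r n))\<^sup>2" by (simp only: of_nat_le_iff)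
  qed
  have low: "(\<lambda>n. S ((r n)\<^sup>2) / real ((r n)\<^sup>2) * (real ((r n)\<^sup>2) / real n)) \<longlonglongrightarrow> \<mu> * 1"
  proof (intro tendsto_mult)
    show "(\<lambda>n. S ((r n)\<^sup>2) / real ((r n)\<^sup>2)) \<longlonglongrightarrow> \<mu>"
      by (rule filterlim_compose[OF lim r_lim])
    show "(\<lambda>n. real ((r n)\<^sup>2) / real n) \<longlonglongrightarrow> 1"
      unfolding r_def of_nat_power by real_asymp
  qed
  have up: "(\<lambda>n. S ((Suc (r n))\<^sup>2) / real ((Suc (r n))\<^sup>2) * (real ((Suc (r n))\<^sup>2) / real n))
      \<longlonglongrightarrow> \<mu> * 1"
  proof (intro tendsto_mult)
    show "(\<lambda>n. S ((Suc (r n))\<^sup>2) / real ((Suc (r n))\<^sup>2)) \<longlonglongrightarrow> \<mu>"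
      by (rule filterlim_compose[OF lim filterlim_compose[OF filterlim_Suc r_lim]])
    show "(\<lambda>n. real ((Suc (r n))\<^sup>2) / real n) \<longlonglongrightarrow> 1"
      unfolding r_def of_nat_power of_nat_Suc by real_asymp
  qed
  show ?thesis
  proof (rule tendsto_sandwich)
    show "(\<lambda>n. S ((r n)\<^sup>2) / real ((r n)\<^sup>2) * (real ((r n)\<^sup>2) / real n)) \<longlonglongrightarrow> \<mu>"
      using low by simp
    show "(\<lambda>n. S ((Suc (r n))\<^sup>2) / real ((Suc (r n))\<^sup>2) * (real ((Suc (r n))\<^sup>2) / real n)) \<longlonglongrightarrow> \<mu>"
      using up by simp
    show "\<forall>\<^sub>F n in sequentially.
        S ((r n)\<^sup>2) / real ((r n)\<^sup>2) * (real ((r n)\<^sup>2) / real n) \<le> S n / real n"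
    proof (rule always_eventually, rule allI)
      fix n
      show "S ((r n)\<^sup>2) / real ((r n)\<^sup>2) * (real ((r n)\<^sup>2) / real n) \<le> S n / real n"
      \<comment> \<open>Cancelling the square needs \<open>r n\<close> nonzero. If it is zero, the
        left side is 0 by the convention for division by zero, and nonnegativity of \<open>S\<close>
        suffices.\<close>
      proof (cases "r n = 0")
        case True
        then show ?thesis by (simp add: nonneg)
      next
        case False
        then show ?thesis using monoD[OF mono r_le[of n]] by (simp add: divide_right_mono)
      qed
    qed
    show "\<forall>\<^sub>F n in sequentially. S n / real n \<le>
        S ((Suc (r n))\<^sup>2) / real ((Suc (r n))\<^sup>2) * (real ((Suc (r n))\<^sup>2) / real n)"
      using monoD[OF mono le_r] by (simp add: divide_right_mono del: of_nat_Suc of_nat_power)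
  qed
qed

text \<open>In the expanded square the mixed terms vanish: by independence their expectation factors
  into a product of zero means.\<close>

lemma (in prob_space) second_moment_sum_indep:
  fixes Y :: "'b \<Rightarrow> 'a \<Rightarrow> real"
  assumes "finite I" and indep: "indep_vars (\<lambda>_. borel) Y I"
    and int: "\<And>i. i \<in> I \<Longrightarrow> integrable M (Y i)"
    and mean: "\<And>i. i \<in> I \<Longrightarrow> expectation (Y i) = 0"
    and sq: "\<And>i. i \<in> I \<Longrightarrow> integrable M (\<lambda>\<omega>. (Y i \<omega>)\<^sup>2)"
  shows "integrable M (\<lambda>\<omega>. (\<Sum>i\<in>I. Y i \<omega>)\<^sup>2)"
    and "expectation (\<lambda>\<omega>. (\<Sum>i\<in>I. Y i \<omega>)\<^sup>2) = (\<Sum>i\<in>I. expectation (\<lambda>\<omega>. (Y i \<omega>)\<^sup>2))"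
proof -
  \<comment> \<open>The condition is written \<open>j = i\<close> so that \<open>sum.delta\<close>
    collapses the inner sum over \<open>j\<close> to the diagonal.\<close>
  have prods: "integrable M (\<lambda>\<omega>. Y i \<omega> * Y j \<omega>) \<and>
      expectation (\<lambda>\<omega>. Y i \<omega> * Y j \<omega>) = (if j = i then expectation (\<lambda>\<omega>. (Y i \<omega>)\<^sup>2) else 0)"
    if ij: "i \<in> I" "j \<in> I" for i j
  proof (cases "i = j")
    case True
    then show ?thesis using sq[OF ij(1)] by (simp add: power2_eq_square)
  next
    case False
    have ind: "indep_vars (\<lambda>_. borel) Y {i, j}"
      by (rule indep_vars_subset[OF indep]) (use ij in auto)
    have int': "integrable M (Y k)" if "k \<in> {i, j}" for k
      using that ij int by auto
    show ?thesis
      using indep_vars_integrable[OF _ ind int'] indep_vars_lebesgue_integral[OF _ ind int'] False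
      by (simp add: mean ij)
  qed
  have expand: "(\<Sum>i\<in>I. Y i \<omega>)\<^sup>2 = (\<Sum>i\<in>I. \<Sum>j\<in>I. Y i \<omega> * Y j \<omega>)" for \<omega>
    by (simp add: power2_eq_square sum_product)
  show "integrable M (\<lambda>\<omega>. (\<Sum>i\<in>I. Y i \<omega>)\<^sup>2)"
    unfolding expand using prods by (intro Bochner_Integration.integrable_sum) blast
  have "expectation (\<lambda>\<omega>. (\<Sum>i\<in>I. Y i \<omega>)\<^sup>2)
      = (\<Sum>i\<in>I. \<Sum>j\<in>I. expectation (\<lambda>\<omega>. Y i \<omega> * Y j \<omega>))"
    unfolding expand using prods
    by (simp add: Bochner_Integration.integral_sum Bochner_Integration.integrable_sum)
  also have "\<dots> = (\<Sum>i\<in>I. expectation (\<lambda>\<omega>. (Y i \<omega>)\<^sup>2))"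
    using prods \<open>finite I\<close> by (simp add: sum.delta)
  finally show "expectation (\<lambda>\<omega>. (\<Sum>i\<in>I. Y i \<omega>)\<^sup>2) = (\<Sum>i\<in>I. expectation (\<lambda>\<omega>. (Y i \<omega>)\<^sup>2))" .
qed

text \<open>By monotone convergence the series of the \<open>Z k\<close> has finite integral, hence
  is finite almost everywhere, and the terms of a convergent series tend to 0. This does the work of
  Chebyshev and Borel-Cantelli. The sum is taken in \<open>ennreal\<close>, where sum and integral
  may be swapped before convergence is known.\<close>

lemma AE_tendsto_0_of_summable_expectation:
  fixes Z :: "nat \<Rightarrow> 'a \<Rightarrow> real"
  assumes int: "\<And>k. integrable M (Z k)" and nonneg: "\<And>k \<omega>. 0 \<le> Z k \<omega>"
    and summable: "summable (\<lambda>k. \<integral>\<omega>. Z k \<omega> \<partial>M)"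
  shows "AE \<omega> in M. (\<lambda>k. Z k \<omega>) \<longlonglongrightarrow> 0"
proof -
  have meas [measurable]: "Z k \<in> borel_measurable M" for k
    using int by (rule borel_measurable_integrable)
  have "(\<integral>\<^sup>+\<omega>. (\<Sum>k. ennreal (Z k \<omega>)) \<partial>M) = (\<Sum>k. \<integral>\<^sup>+\<omega>. ennreal (Z k \<omega>) \<partial>M)"
    by (rule nn_integral_suminf) measurable
  also have "\<dots> = (\<Sum>k. ennreal (\<integral>\<omega>. Z k \<omega> \<partial>M))"
    by (intro suminf_cong nn_integral_eq_integral int) (simp add: nonneg)
  also have "\<dots> = ennreal (\<Sum>k. \<integral>\<omega>. Z k \<omega> \<partial>M)"
    by (intro suminf_ennreal2 summable) (simp add: nonneg)
  finally have "(\<integral>\<^sup>+\<omega>. (\<Sum>k. ennreal (Z k \<omega>)) \<partial>M) \<noteq> \<infinity>" by simp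
  then have "AE \<omega> in M. (\<Sum>k. ennreal (Z k \<omega>)) \<noteq> \<infinity>"
    by (intro nn_integral_PInf_AE) measurable
  then show ?thesis
  proof eventually_elim
    case (elim \<omega>)
    have "summable (\<lambda>k. Z k \<omega>)"
      by (rule summable_suminf_not_top) (use elim nonneg in auto)
    then show ?case by (rule summable_LIMSEQ_zero)
  qed
qed

text \<open>Identical distribution enters only as a common mean and a common variance bound
  \<open>v\<close>. Nonnegativity makes the partial sums monotone, which fills the gaps between
  squares.\<close>

theorem (in prob_space) strong_law_nonneg:
  fixes X :: "nat \<Rightarrow> 'a \<Rightarrow> real"
  assumes indep: "indep_vars (\<lambda>_. borel) X {1..}"
    and nonneg: "\<And>n. n \<ge> 1 \<Longrightarrow> AE \<omega> in M. 0 \<le> X n \<omega>"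
    and int: "\<And>n. n \<ge> 1 \<Longrightarrow> integrable M (X n)"
    and mean: "\<And>n. n \<ge> 1 \<Longrightarrow> expectation (X n) = \<mu>"
    and sq: "\<And>n. n \<ge> 1 \<Longrightarrow> integrable M (\<lambda>\<omega>. (X n \<omega> - \<mu>)\<^sup>2)"
    and var: "\<And>n. n \<ge> 1 \<Longrightarrow> expectation (\<lambda>\<omega>. (X n \<omega> - \<mu>)\<^sup>2) \<le> v"
  shows "AE \<omega> in M. (\<lambda>n. (\<Sum>i=1..n. X i \<omega>) / real n) \<longlonglongrightarrow> \<mu>"
proof -
  define Y where "Y i \<omega> = X i \<omega> - \<mu>" for i \<omega>
  \<comment> \<open>The squared deviation from the mean of the average over \<open>k\<^sup>2\<close>
    terms.\<close>
  define Z where "Z k \<omega> = (\<Sum>i=1..k\<^sup>2. Y i \<omega>)\<^sup>2 / (real (k\<^sup>2))\<^sup>2" for k \<omega>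
  have indep_Y: "indep_vars (\<lambda>_. borel) Y {1..n}" for n
  proof (rule indep_vars_subset)
    show "indep_vars (\<lambda>_. borel) Y {1..}"
      unfolding Y_def by (rule indep_vars_compose2[OF indep]) simp
  qed auto
  have Y_int: "integrable M (Y i)" and Y_mean: "expectation (Y i) = 0"
    and Y_sq: "integrable M (\<lambda>\<omega>. (Y i \<omega>)\<^sup>2)" if "i \<ge> 1" for i
    using int[OF that] mean[OF that] sq[OF that] by (simp_all add: Y_def[abs_def] prob_space)
  have sum_sq: "integrable M (\<lambda>\<omega>. (\<Sum>i=1..n. Y i \<omega>)\<^sup>2)"
    "expectation (\<lambda>\<omega>. (\<Sum>i=1..n. Y i \<omega>)\<^sup>2) = (\<Sum>i=1..n. expectation (\<lambda>\<omega>. (Y i \<omega>)\<^sup>2))" for n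
    using second_moment_sum_indep[of "{1..n}" Y] indep_Y Y_int Y_mean Y_sq by auto
  have Z_int: "integrable M (Z k)" for k
    unfolding Z_def using sum_sq(1) by (rule integrable_divide)
  have Z_nonneg: "0 \<le> Z k \<omega>" for k \<omega>
    by (simp add: Z_def)
  \<comment> \<open>There are k^2 summands of size at most \<open>v\<close>, divided by k^4. At
    \<open>k = 0\<close> both sides are 0 by convention.\<close>
  have Z_bound: "expectation (Z k) \<le> v * inverse ((real k)\<^sup>2)" for k
  proof (cases "k = 0")
    case False
    have "expectation (Z k) = (\<Sum>i=1..k\<^sup>2. expectation (\<lambda>\<omega>. (Y i \<omega>)\<^sup>2)) / (real (k\<^sup>2))\<^sup>2"
      unfolding Z_def using sum_sq(2)[of "k\<^sup>2"] by simp
    also have "\<dots> \<le> (\<Sum>i=1..k\<^sup>2. v) / (real (k\<^sup>2))\<^sup>2"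
      by (intro divide_right_mono sum_mono) (auto simp: Y_def intro: var)
    also have "\<dots> = v * inverse ((real k)\<^sup>2)"
      using False by (simp add: field_simps power2_eq_square)
    finally show ?thesis .
  qed (simp add: Z_def[abs_def])
  have "summable (\<lambda>k. expectation (Z k))"
  proof (rule summable_comparison_test')
    show "summable (\<lambda>k. v * inverse ((real k)\<^sup>2))"
      by (intro summable_mult inverse_power_summable) simp
    show "norm (expectation (Z k)) \<le> v * inverse ((real k)\<^sup>2)" for k
      using Z_bound[of k] by (simp add: Z_nonneg)
  qed
  then have "AE \<omega> in M. (\<lambda>k. Z k \<omega>) \<longlonglongrightarrow> 0"
    by (intro AE_tendsto_0_of_summable_expectation Z_int Z_nonneg)
  \<comment> \<open>Countably many null sets are merged into one, so that whole paths are
    nonnegative.\<close>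
  moreover have "AE \<omega> in M. \<forall>n\<in>{1..}. 0 \<le> X n \<omega>"
    using nonneg by (subst AE_ball_countable) auto
  ultimately show ?thesis
  proof eventually_elim
    case (elim \<omega>)
    define S where "S n = (\<Sum>i=1..n. X i \<omega>)" for n
    have S_Y: "(\<Sum>i=1..n. Y i \<omega>) = S n - real n * \<mu>" for n
      by (simp add: S_def Y_def sum_subtractf)
    have "(\<lambda>k. sqrt (Z k \<omega>)) \<longlonglongrightarrow> 0"
      using tendsto_real_sqrt[OF elim(1)] by simp
    moreover have "sqrt (Z k \<omega>) = \<bar>(S (k\<^sup>2) - real (k\<^sup>2) * \<mu>) / real (k\<^sup>2)\<bar>" for k
      unfolding Z_def S_Y power_divide[symmetric] real_sqrt_abs ..
    ultimately have dev: "(\<lambda>k. (S (k\<^sup>2) - real (k\<^sup>2) * \<mu>) / real (k\<^sup>2)) \<longlonglongrightarrow> 0"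
      by (simp only: tendsto_rabs_zero_iff)
    have "(\<lambda>k. (S (k\<^sup>2) - real (k\<^sup>2) * \<mu>) / real (k\<^sup>2) + \<mu>) \<longlonglongrightarrow> 0 + \<mu>"
      by (intro tendsto_add dev tendsto_const)
    \<comment> \<open>At \<open>k = 0\<close> the left side is \<open>\<mu>\<close> and the right
      side 0, so the equality is only claimed eventually.\<close>
    moreover have "\<forall>\<^sub>F k in sequentially.
        (S (k\<^sup>2) - real (k\<^sup>2) * \<mu>) / real (k\<^sup>2) + \<mu> = S (k\<^sup>2) / real (k\<^sup>2)"
      using eventually_gt_at_top[of 0] by eventually_elim (simp add: diff_divide_distrib)
    ultimately have lim: "(\<lambda>k. S (k\<^sup>2) / real (k\<^sup>2)) \<longlonglongrightarrow> \<mu>"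
      using tendsto_cong by force
    have "mono S"
      unfolding mono_iff_le_Suc S_def using elim(2) by simp
    moreover have "0 \<le> S n" for n
      unfolding S_def using elim(2) by (intro sum_nonneg) auto
    ultimately have "(\<lambda>n. S n / real n) \<longlonglongrightarrow> \<mu>"
      using lim by (rule average_tendsto_from_squares)
    then show ?case by (simp add: S_def)
  qed
qed

section \<open>Growth rate of a Lindley recursion\<close>

text \<open>From below, \<open>e\<close> dominates both 0 and \<open>u\<close>. From above, a line
  of slope slightly larger than \<open>max 0 c\<close> dominates \<open>u\<close>, and being
  increasing it dominates the running maximum as well.\<close>

lemma running_max_growth:
  fixes u e :: "nat \<Rightarrow> real"
  assumes init: "e 0 = 0" and step: "\<And>n. e (Suc n) = max (u (Suc n)) (e n)"
    and lim: "(\<lambda>n. u n / real n) \<longlonglongrightarrow> c"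
  shows "(\<lambda>n. e n / real n) \<longlonglongrightarrow> max 0 c"
proof -
  have e_nonneg: "0 \<le> e n" for n
    by (induction n) (auto simp: init step)
  have e_ge: "u n \<le> e n" if "n > 0" for n
    using that step by (cases n) auto
  show ?thesis
  proof (rule tendstoI)
    fix \<epsilon> :: real assume "\<epsilon> > 0"
    \<comment> \<open>Half of \<open>\<epsilon>\<close> goes into the slope, making it positive and
      larger than \<open>c\<close>; the other half later absorbs \<open>K / real n\<close>.\<close>
    define d where "d = max 0 c + \<epsilon> / 2"
    have "d > 0" "d > c" using \<open>\<epsilon> > 0\<close> by (auto simp: d_def)
    from order_tendstoD(2)[OF lim \<open>d > c\<close>]
    obtain N where N: "u n / real n < d" if "n \<ge> N" for n
      by (auto simp: eventually_sequentially)
    \<comment> \<open>An intercept covering the finitely many early indices at which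
      \<open>u\<close> may exceed the line through the origin.\<close>
    define K where "K = (\<Sum>n\<le>N. \<bar>u n\<bar>)"
    have u_le: "u n \<le> K + d * real n" if "n > 0" for n
    proof (cases "n \<le> N")
      case True
      have "\<bar>u n\<bar> \<le> K" unfolding K_def using True by (intro member_le_sum) auto
      moreover have "0 \<le> d * real n" using \<open>d > 0\<close> by simp
      ultimately show ?thesis by linarith
    next
      case False
      then have "u n < d * real n" using N[of n] that by (simp add: field_simps)
      moreover have "0 \<le> K" unfolding K_def by (simp add: sum_nonneg)
      ultimately show ?thesis by simp
    qed
    have e_le: "e n \<le> K + d * real n" for n
    proof (induction n)
      case 0
      show ?case by (simp add: init K_def sum_nonneg)
    next
      case (Suc n)
      then show ?case using u_le[of "Suc n"] \<open>d > 0\<close> by (simp add: step algebra_simps)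
    qed
    have "(\<lambda>n. K / real n) \<longlonglongrightarrow> 0" by (rule lim_const_over_n)
    then have "\<forall>\<^sub>F n in sequentially. K / real n < \<epsilon> / 2"
      using \<open>\<epsilon> > 0\<close> by (intro order_tendstoD(2)) auto
    moreover have "\<forall>\<^sub>F n in sequentially. u n / real n > c - \<epsilon>"
      using lim \<open>\<epsilon> > 0\<close> by (intro order_tendstoD(1)) auto
    ultimately show "\<forall>\<^sub>F n in sequentially. dist (e n / real n) (max 0 c) < \<epsilon>"
      using eventually_gt_at_top[of 0]
    proof eventually_elim
      case (elim n)
      have "e n / real n \<le> (K + d * real n) / real n"
        using e_le by (intro divide_right_mono) auto
      also have "\<dots> = K / real n + d" using elim by (simp add: field_simps)
      finally have "e n / real n < max 0 c + \<epsilon>" using elim unfolding d_def by linarith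
      moreover have "u n / real n \<le> e n / real n"
        using e_ge elim by (intro divide_right_mono) auto
      moreover have "0 \<le> e n / real n" using e_nonneg by simp
      ultimately show ?case using elim \<open>\<epsilon> > 0\<close> by (auto simp: dist_real_def abs_less_iff max_def)
    qed
  qed
qed

text \<open>Each step adds \<open>s (Suc n)\<close> after the maximum, so subtracting partial sums
  leaves a pure running maximum of rate \<open>max 0 (a - b)\<close>. Adding back the rate
  \<open>b\<close> gives \<open>max a b\<close>.\<close>

lemma lindley_growth:
  fixes A s d :: "nat \<Rightarrow> real"
  assumes init: "d 0 = 0" and step: "\<And>n. d (Suc n) = max (A (Suc n)) (d n) + s (Suc n)"
    and A_lim: "(\<lambda>n. A n / real n) \<longlonglongrightarrow> a"
    and s_lim: "(\<lambda>n. (\<Sum>i=1..n. s i) / real n) \<longlonglongrightarrow> b"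
  shows "(\<lambda>n. d n / real n) \<longlonglongrightarrow> max a b"
proof -
  define T where "T n = (\<Sum>i=1..n. s i)" for n
  have T_lim: "(\<lambda>n. T n / real n) \<longlonglongrightarrow> b"
    using s_lim by (simp add: T_def)
  have "(\<lambda>n. T n / real n * (real n / real (Suc n))) \<longlonglongrightarrow> b * 1"
    by (intro tendsto_mult T_lim LIMSEQ_n_over_Suc_n)
  \<comment> \<open>At \<open>n = 0\<close> this relies on the empty sum \<open>T 0\<close> being
    0.\<close>
  moreover have "T n / real n * (real n / real (Suc n)) = T n / real (Suc n)" for n
    by (cases "n = 0") (auto simp: T_def)
  ultimately have "(\<lambda>n. T (Suc n - 1) / real (Suc n)) \<longlonglongrightarrow> b"
    by simp
  then have "(\<lambda>n. T (n - 1) / real n) \<longlonglongrightarrow> b"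
    by (rule LIMSEQ_imp_Suc)
  then have u_lim: "(\<lambda>n. (A n - T (n - 1)) / real n) \<longlonglongrightarrow> a - b"
    unfolding diff_divide_distrib by (intro tendsto_diff A_lim)
  have "(\<lambda>n. (d n - T n) / real n) \<longlonglongrightarrow> max 0 (a - b)"
  proof (rule running_max_growth[OF _ _ u_lim])
    show "d 0 - T 0 = 0" by (simp add: init T_def)
    \<comment> \<open>The summand \<open>s (Suc n)\<close> cancels against the last term of
      \<open>T (Suc n)\<close>, which is why the arrival term carries the sum with one summand
      fewer.\<close>
    show "d (Suc n) - T (Suc n) = max (A (Suc n) - T (Suc n - 1)) (d n - T n)" for n
      by (simp add: step T_def max_def)
  qed
  then have "(\<lambda>n. (d n - T n) / real n + T n / real n) \<longlonglongrightarrow> max 0 (a - b) + b"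
    by (intro tendsto_add T_lim)
  moreover have "max 0 (a - b) + b = max a b" by simp
  ultimately show ?thesis by (simp add: diff_divide_distrib)
qed

section \<open>The tandem queue\<close>

text \<open>A pathwise statement. With no buffer in between, server 1 starts a customer only after
  the previous one has left server 2, so the pair acts as one server with service time
  \<open>t 1 n + t 2 n\<close>.\<close>

lemma tandem_queue_growth:
  fixes t D :: "nat \<Rightarrow> nat \<Rightarrow> real"
  assumes nonneg: "\<And>i n. i \<in> {1, 2} \<Longrightarrow> n \<ge> 1 \<Longrightarrow> 0 \<le> t i n"
    and init: "\<And>i. i \<in> {0, 1, 2} \<Longrightarrow> D i 0 = 0"
    and D0: "\<And>n. D 0 (Suc n) = D 0 n + t 0 (Suc n)"
    and D1: "\<And>n. D 1 (Suc n) = Max {D 0 (Suc n), D 1 n, D 2 n} + t 1 (Suc n)"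
    and D2: "\<And>n. D 2 (Suc n) = max (D 1 (Suc n)) (D 2 n) + t 2 (Suc n)"
    and lim: "\<And>i. i \<in> {0, 1, 2} \<Longrightarrow> (\<lambda>n. (\<Sum>k=1..n. t i k) / real n) \<longlonglongrightarrow> m i"
  shows "(\<lambda>n. D 2 n / real n) \<longlonglongrightarrow> max (m 0) (m 1 + m 2)"
proof (rule lindley_growth)
  have D1_le_D2: "D 1 n \<le> D 2 n" for n
  proof (cases n)
    case 0
    then show ?thesis by (simp add: init)
  next
    case (Suc k)
    then show ?thesis using D2[of k] nonneg[of 2 "Suc k"] by simp
  qed
  show "D 2 (Suc n) = max (D 0 (Suc n)) (D 2 n) + (t 1 (Suc n) + t 2 (Suc n))" for n
  proof -
    have "Max {D 0 (Suc n), D 1 n, D 2 n} = max (D 0 (Suc n)) (D 2 n)"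
      using D1_le_D2[of n] by (simp add: max_absorb2)
    \<comment> \<open>Nonnegativity of \<open>t 1\<close> gives
      \<open>D 2 n \<le> D 1 (Suc n)\<close>, so the maximum in the recursion for \<open>D 2\<close>
      is its first argument.\<close>
    then show ?thesis using D1[of n] D2[of n] nonneg[of 1 "Suc n"] by auto
  qed
  have "D 0 n = (\<Sum>k=1..n. t 0 k)" for n
    by (induction n) (simp_all add: init D0)
  then show "(\<lambda>n. D 0 n / real n) \<longlonglongrightarrow> m 0"
    using lim[of 0] by simp
  show "(\<lambda>n. (\<Sum>i=1..n. t 1 i + t 2 i) / real n) \<longlonglongrightarrow> m 1 + m 2"
    unfolding sum.distrib add_divide_distrib by (intro tendsto_add lim) auto
qed (simp add: init)

section \<open>From sample paths to probability one\<close>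

theorem mainTheorem3:
  fixes M :: "'a measure"
    and \<tau> :: "nat \<Rightarrow> nat \<Rightarrow> 'a \<Rightarrow> real"
    and D :: "nat \<Rightarrow> nat \<Rightarrow> 'a \<Rightarrow> real"
  assumes prob: "prob_space M"
    and indep_sequences:
      "prob_space.indep_vars M (\<lambda>i. \<Pi>\<^sub>M n\<in>{1..}. borel) (\<lambda>i \<omega>. \<lambda>n\<in>{1..}. \<tau> i n \<omega>) {0, 1, 2}"
    and indep: "\<And>i. i \<in> {0, 1, 2} \<Longrightarrow> prob_space.indep_vars M (\<lambda>n. borel) (\<lambda>n. \<tau> i n) {1..}"
    and ident: "\<And>i n. i \<in> {0, 1, 2} \<Longrightarrow> n \<ge> 1 \<Longrightarrow> distr M borel (\<tau> i n) = distr M borel (\<tau> i 1)"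
    and nonneg: "\<And>i n. i \<in> {0, 1, 2} \<Longrightarrow> n \<ge> 1 \<Longrightarrow> AE \<omega> in M. 0 \<le> \<tau> i n \<omega>"
    and mean_finite: "\<And>i. i \<in> {0, 1, 2} \<Longrightarrow> integrable M (\<tau> i 1)"
    and mean_nonneg: "\<And>i. i \<in> {0, 1, 2} \<Longrightarrow> 0 \<le> (\<integral>\<omega>. \<tau> i 1 \<omega> \<partial>M)"
    and variance_finite:
      "\<And>i. i \<in> {0, 1, 2} \<Longrightarrow> integrable M (\<lambda>\<omega>. (\<tau> i 1 \<omega> - (\<integral>\<omega>'. \<tau> i 1 \<omega>' \<partial>M))\<^sup>2)"
    and D_init: "\<And>i \<omega>. i \<in> {0, 1, 2} \<Longrightarrow> \<omega> \<in> space M \<Longrightarrow> D i 0 \<omega> = 0"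
    and D0: "\<And>n \<omega>. n \<ge> 1 \<Longrightarrow> \<omega> \<in> space M \<Longrightarrow> D 0 n \<omega> = D 0 (n - 1) \<omega> + \<tau> 0 n \<omega>"
    and D1: "\<And>n \<omega>. n \<ge> 1 \<Longrightarrow> \<omega> \<in> space M \<Longrightarrow>
      D 1 n \<omega> = Max {D 0 n \<omega>, D 1 (n - 1) \<omega>, D 2 (n - 1) \<omega>} + \<tau> 1 n \<omega>"
    and D2: "\<And>n \<omega>. n \<ge> 1 \<Longrightarrow> \<omega> \<in> space M \<Longrightarrow>
      D 2 n \<omega> = max (D 1 n \<omega>) (D 2 (n - 1) \<omega>) + \<tau> 2 n \<omega>"
  shows "AE \<omega> in M. (\<lambda>n. 1 / real n * D 2 n \<omega>) \<longlonglongrightarrow>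
    max (\<integral>\<omega>. \<tau> 0 1 \<omega> \<partial>M) ((\<integral>\<omega>. \<tau> 1 1 \<omega> \<partial>M) + (\<integral>\<omega>. \<tau> 2 1 \<omega> \<partial>M))"
proof -
  interpret prob_space M by (rule prob)
  let ?m = "\<lambda>i. \<integral>\<omega>. \<tau> i 1 \<omega> \<partial>M"
  have slln: "AE \<omega> in M. (\<lambda>n. (\<Sum>k=1..n. \<tau> i k \<omega>) / real n) \<longlonglongrightarrow> ?m i"
    if i: "i \<in> {0, 1, 2}" for i
  proof -
    have meas: "\<tau> i n \<in> borel_measurable M" if "n \<ge> 1" for n
      using indep[OF i] that by (simp add: indep_vars_def2)
    \<comment> \<open>Equal laws give equal integrals. Taking \<open>f\<close> as the identity and
      as the squared deviation yields the common mean and the bound \<open>v\<close>, here the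
      variance of \<open>\<tau> i 1\<close>.\<close>
    have transfer: "integrable M (\<lambda>\<omega>. f (\<tau> i n \<omega>)) \<longleftrightarrow> integrable M (\<lambda>\<omega>. f (\<tau> i 1 \<omega>))"
      "expectation (\<lambda>\<omega>. f (\<tau> i n \<omega>)) = expectation (\<lambda>\<omega>. f (\<tau> i 1 \<omega>))"
      if n: "n \<ge> 1" and f: "f \<in> borel_measurable borel" for n and f :: "real \<Rightarrow> real"
      using integrable_distr_eq[OF meas f] integral_distr[OF meas f] ident[OF i n] n
      by (metis order_refl)+
    show ?thesis
    proof (rule strong_law_nonneg[OF indep[OF i] nonneg[OF i]])
      fix n :: nat assume n: "n \<ge> 1"
      show "integrable M (\<tau> i n)" "expectation (\<tau> i n) = ?m i"
        using transfer[OF n, of "\<lambda>x. x"] mean_finite[OF i] by auto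
      show "integrable M (\<lambda>\<omega>. (\<tau> i n \<omega> - ?m i)\<^sup>2)"
        "expectation (\<lambda>\<omega>. (\<tau> i n \<omega> - ?m i)\<^sup>2) \<le> expectation (\<lambda>\<omega>. (\<tau> i 1 \<omega> - ?m i)\<^sup>2)"
        using transfer[OF n, of "\<lambda>x. (x - ?m i)\<^sup>2"] variance_finite[OF i] by auto
    qed
  qed
  have "AE \<omega> in M. \<forall>i\<in>{0, 1, 2}. (\<lambda>n. (\<Sum>k=1..n. \<tau> i k \<omega>) / real n) \<longlonglongrightarrow> ?m i"
    using slln by (subst AE_ball_countable) auto
  moreover have "AE \<omega> in M. \<forall>i\<in>{0, 1, 2}. \<forall>n\<in>{1..}. 0 \<le> \<tau> i n \<omega>"
    using nonneg by (simp add: AE_ball_countable)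
  ultimately show ?thesis
    \<comment> \<open>The recursions are assumed only for points of \<open>space M\<close>.\<close>
    using AE_space
  proof eventually_elim
    case (elim \<omega>)
    have "(\<lambda>n. D 2 n \<omega> / real n) \<longlonglongrightarrow> max (?m 0) (?m 1 + ?m 2)"
    proof (rule tandem_queue_growth[where t = "\<lambda>i n. \<tau> i n \<omega>" and D = "\<lambda>i n. D i n \<omega>"])
      show "0 \<le> \<tau> i n \<omega>" if "i \<in> {1, 2}" "n \<ge> 1" for i n
        using elim(2) that by auto
    qed (use elim(1,3) D_init D0[of "Suc _"] D1[of "Suc _"] D2[of "Suc _"] in auto)
    then show ?case by simp
  qed
qed

end
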